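(* Let $I=[0,1]$ be equipped with a metric $\varrho$ compatible with the Euclidean topology, let $f\colon I\to I$ be continuous, and let $x\in I$ be such that $\omega_f(x)$ is finite. Then, for every $m\in\mathbb{N}$, $$\lim_{\varepsilon\to0}\operatorname{rdet}_m(x,\varepsilon)=1.$$
   Context: $\mathbb{N}=\{1,2,\dots\}$. For $m\in\mathbb{N}$, Bowen's metric is $\varrho_m(x,y)=\max\{\varrho(f^i(x),f^i(y)):0\le i<m\}$. For $x\in I$, $n\in\mathbb{N}$, $\varepsilon>0$, $$C_m(x,n,\varepsilon)=\frac1{n^2}\#\{(i,j):0\le i,j<n,\ \varrho_m(f^i(x),f^j(x))\le\varepsilon\},\qquad \operatorname{rdet}_m(x,n,\varepsilon)=\frac{C_m(x,n,\varepsilon)}{C_1(x,n,\varepsilon)}.$$ The asymptotic recurrence $m$-determinism is $\operatorname{rdet}_m(x,\varepsilon)=\lim_{n\to\infty}\operatorname{rdet}_m(x,n,\varepsilon)$, whenever this limit exists; the claim includes that it exists for all sufficiently small $\varepsilon>0$. $\omega_f(x)$ is the set of all limit points of the trajectory $(f^n(x))_{n\ge0}$. *)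

theory Defs
  imports "HOL-Analysis.Analysis"
begin

text \<open>For \<open>m = 0\<close> the maximum is over the empty set and has no meaning; only \<open>m \<ge> 1\<close> is intended.\<close>

definition bowen_dist ::
  "('a \<Rightarrow> 'a \<Rightarrow> real) \<Rightarrow> ('a \<Rightarrow> 'a) \<Rightarrow> nat \<Rightarrow> 'a \<Rightarrow> 'a \<Rightarrow> real"
where
  "bowen_dist \<rho> f m x y = Max {\<rho> ((f ^^ i) x) ((f ^^ i) y) | i. i < m}"

definition corr_sum ::
  "('a \<Rightarrow> 'a \<Rightarrow> real) \<Rightarrow> ('a \<Rightarrow> 'a) \<Rightarrow> nat \<Rightarrow> 'a \<Rightarrow> nat \<Rightarrow> real \<Rightarrow> real"
where
  "corr_sum \<rho> f m x n \<epsilon> =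
     real (card {(i, j). i < n \<and> j < n \<and> bowen_dist \<rho> f m ((f ^^ i) x) ((f ^^ j) x) \<le> \<epsilon>})
       / (real n)\<^sup>2"

definition rdet ::
  "('a \<Rightarrow> 'a \<Rightarrow> real) \<Rightarrow> ('a \<Rightarrow> 'a) \<Rightarrow> nat \<Rightarrow> 'a \<Rightarrow> nat \<Rightarrow> real \<Rightarrow> real"
where
  "rdet \<rho> f m x n \<epsilon> = corr_sum \<rho> f m x n \<epsilon> / corr_sum \<rho> f 1 x n \<epsilon>"

text \<open>The value of \<open>lim\<close> is meaningful only when the sequence is \<open>convergent\<close>, so existence
  of the limit has to be asserted separately.\<close>

definition asym_rdet ::
  "('a \<Rightarrow> 'a \<Rightarrow> real) \<Rightarrow> ('a \<Rightarrow> 'a) \<Rightarrow> nat \<Rightarrow> 'a \<Rightarrow> real \<Rightarrow> real"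
where
  "asym_rdet \<rho> f m x \<epsilon> = lim (\<lambda>n. rdet \<rho> f m x n \<epsilon>)"

text \<open>Limit points are those of the trajectory as a sequence, i.e. limits of subsequences, and
  not accumulation points of its range: a periodic point has its whole orbit as omega-limit set.\<close>

definition omega_limit_set ::
  "('a \<Rightarrow> 'a) \<Rightarrow> 'a \<Rightarrow> 'a::topological_space set"
where
  "omega_limit_set f x =
     {y. \<exists>r::nat \<Rightarrow> nat. strict_mono r \<and> (\<lambda>k. (f ^^ r k) x) \<longlonglongrightarrow> y}"

end

theory Submission
  imports Defs
begin

text \<open>By compactness the trajectory eventually stays in the union of small neighbourhoods
  \<open>U y\<close> of the finitely many points \<open>y\<close> of the omega-limit set. For \<open>\<epsilon>\<close> below
  half the separation of these points and small enough \<open>U y\<close>, two late points of the trajectory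
  are \<open>\<epsilon>\<close>-close if and only if they lie in the same \<open>U y\<close>, if and only if they are \<open>\<epsilon>\<close>-close in
  Bowen's metric. So the counts defining \<open>C\<^sub>m\<close> and \<open>C\<^sub>1\<close> differ by \<open>O(n)\<close>, whereas the one for \<open>C\<^sub>1\<close>
  grows quadratically by the Cauchy-Schwarz inequality; hence \<open>rdet\<^sub>m(x, \<epsilon>) = 1\<close>.\<close>

section \<open>Bowen balls and counting pairs of indices\<close>

lemma bowen_dist_le_iff:
  assumes "m \<ge> 1"
  shows "bowen_dist \<rho> f m x y \<le> e \<longleftrightarrow> (\<forall>i<m. \<rho> ((f ^^ i) x) ((f ^^ i) y) \<le> e)"
proof -
  have eq: "{\<rho> ((f ^^ i) x) ((f ^^ i) y) |i. i < m} = (\<lambda>i. \<rho> ((f ^^ i) x) ((f ^^ i) y)) ` {..<m}"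
    by auto
  show ?thesis
    unfolding bowen_dist_def eq using assms by (subst Max_le_iff) (auto simp: lessThan_empty_iff)
qed

text \<open>Cauchy-Schwarz over the fibres of \<open>b\<close>: the pairs with equal labels form the
  disjoint union of the squares of the fibres, and the fibre sizes add up to
  \<open>card A\<close>.\<close>

lemma card_eq_pairs_ge:
  fixes b :: "'i \<Rightarrow> 'c"
  assumes "finite A" "finite S" "b ` A \<subseteq> S"
  shows "(real (card A))\<^sup>2 \<le> real (card S) * real (card {(i, j) \<in> A \<times> A. b i = b j})"
proof -
  define F where "F y = {i \<in> A. b i = y}" for y
  have finF: "finite (F y)" for y
    using assms(1) by (auto simp: F_def)
  have "A = (\<Union>y\<in>S. F y)"
    using assms(3) by (auto simp: F_def)
  then have "card A = card (\<Union>y\<in>S. F y)"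
    by simp
  also have "\<dots> = (\<Sum>y\<in>S. card (F y))"
    using assms finF by (intro card_UN_disjoint) (auto simp: F_def)
  finally have cA: "card A = (\<Sum>y\<in>S. card (F y))" .
  have "{(i, j) \<in> A \<times> A. b i = b j} = (\<Union>y\<in>S. F y \<times> F y)"
    using assms(3) by (auto simp: F_def)
  then have "card {(i, j) \<in> A \<times> A. b i = b j} = card (\<Union>y\<in>S. F y \<times> F y)"
    by simp
  also have "\<dots> = (\<Sum>y\<in>S. card (F y \<times> F y))"
    using assms finF by (intro card_UN_disjoint) (auto simp: F_def)
  finally have cP: "card {(i, j) \<in> A \<times> A. b i = b j} = (\<Sum>y\<in>S. (card (F y))\<^sup>2)"
    by (simp add: card_cartesian_product power2_eq_square)
  have "(\<Sum>y\<in>S. real (card (F y)))\<^sup>2 \<le> (\<Sum>y\<in>S. (real (card (F y)))\<^sup>2) * real (card S)"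
    by (rule sum_squared_le_sum_of_squares)
  then show ?thesis
    unfolding cA cP by (simp add: mult.commute)
qed

text \<open>An exceptional pair has a coordinate below \<open>N\<close>, so it lies in one of two
  strips of \<open>N * n\<close> pairs each.\<close>

lemma card_pairs_le_add:
  fixes P Q :: "nat \<Rightarrow> nat \<Rightarrow> bool"
  assumes "\<And>i j. N \<le> i \<Longrightarrow> N \<le> j \<Longrightarrow> P i j \<Longrightarrow> Q i j"
  shows "card {(i, j). i < n \<and> j < n \<and> P i j}
           \<le> card {(i, j). i < n \<and> j < n \<and> Q i j} + 2 * N * n"
proof -
  have fin: "finite {(i, j). i < n \<and> j < n \<and> Q i j}"
    by (rule finite_subset[of _ "{..<n} \<times> {..<n}"]) auto
  have "card {(i, j). i < n \<and> j < n \<and> P i j}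
      \<le> card ({(i, j). i < n \<and> j < n \<and> Q i j} \<union> ({..<N} \<times> {..<n} \<union> {..<n} \<times> {..<N}))"
    using fin assms by (intro card_mono) (auto simp: not_less)
  also have "\<dots> \<le> card {(i, j). i < n \<and> j < n \<and> Q i j}
                + (card ({..<N} \<times> {..<n}) + card ({..<n} \<times> {..<N}))"
    by (intro order_trans[OF card_Un_le] add_mono card_Un_le order_refl)
  finally show ?thesis
    by (simp add: card_cartesian_product algebra_simps)
qed

text \<open>Isolates the combinatorics. Later \<open>P\<close> and \<open>Q\<close> are
  \<epsilon>-closeness in Bowen's metrics of orders \<open>m\<close> and 1, and \<open>b i\<close>
  is a limit point near the \<open>i\<close>-th iterate. Finiteness of \<open>S\<close> forces many
  coincidences of labels.\<close>

lemma card_pairs_ratio_tendsto_1: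
  fixes P Q :: "nat \<Rightarrow> nat \<Rightarrow> bool" and b :: "nat \<Rightarrow> 'c"
  assumes "finite S" and "\<And>i. N \<le> i \<Longrightarrow> b i \<in> S"
    and P: "\<And>i j. N \<le> i \<Longrightarrow> N \<le> j \<Longrightarrow> P i j \<longleftrightarrow> b i = b j"
    and Q: "\<And>i j. N \<le> i \<Longrightarrow> N \<le> j \<Longrightarrow> Q i j \<longleftrightarrow> b i = b j"
  shows "(\<lambda>n. real (card {(i, j). i < n \<and> j < n \<and> P i j})
            / real (card {(i, j). i < n \<and> j < n \<and> Q i j})) \<longlonglongrightarrow> 1"
proof -
  define p where "p n = real (card {(i, j). i < n \<and> j < n \<and> P i j})" for n
  define q where "q n = real (card {(i, j). i < n \<and> j < n \<and> Q i j})" for n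
  define s where "s = real (card S)"
  \<comment> \<open>\<open>S\<close> contains \<open>b N\<close>, so it is nonempty.\<close>
  have spos: "s > 0"
    using assms(1,2) by (auto simp: s_def card_gt_0_iff)
  have diff: "\<bar>p n - q n\<bar> \<le> 2 * real N * real n" for n
  proof -
    have "card {(i, j). i < n \<and> j < n \<and> P i j}
           \<le> card {(i, j). i < n \<and> j < n \<and> Q i j} + 2 * N * n"
         "card {(i, j). i < n \<and> j < n \<and> Q i j}
           \<le> card {(i, j). i < n \<and> j < n \<and> P i j} + 2 * N * n"
      using P Q by (intro card_pairs_le_add; simp)+
    then have "p n \<le> q n + real (2 * N * n)" "q n \<le> p n + real (2 * N * n)"
      unfolding p_def q_def of_nat_add[symmetric] of_nat_le_iff by simp_all
    then show ?thesis
      by simp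
  qed
  \<comment> \<open>For \<open>n \<ge> 2 * N\<close> the tail \<open>{N..<n}\<close> has at least
    \<open>n / 2\<close> elements; squaring this gives the factor 4.\<close>
  have low: "(real n)\<^sup>2 \<le> 4 * s * q n" if "n \<ge> 2 * N" for n
  proof -
    have "finite {(i, j). i < n \<and> j < n \<and> Q i j}"
      by (rule finite_subset[of _ "{..<n} \<times> {..<n}"]) auto
    then have "card {(i, j) \<in> {N..<n} \<times> {N..<n}. b i = b j}
        \<le> card {(i, j). i < n \<and> j < n \<and> Q i j}"
      using Q by (intro card_mono) auto
    moreover have "(real (card {N..<n}))\<^sup>2
        \<le> s * real (card {(i, j) \<in> {N..<n} \<times> {N..<n}. b i = b j})"
      unfolding s_def using assms(1,2) by (intro card_eq_pairs_ge) auto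
    ultimately have "(real (card {N..<n}))\<^sup>2 \<le> s * q n"
      unfolding q_def using spos by (meson order_trans mult_left_mono less_imp_le of_nat_mono)
    moreover have "(real n / 2)\<^sup>2 \<le> (real (card {N..<n}))\<^sup>2"
      using that by (intro power_mono) auto
    ultimately show ?thesis
      by (simp add: power_divide)
  qed
  \<comment> \<open>The constant 8 is 2 from \<open>diff\<close> times 4 from \<open>low\<close>.
    The extra 1 in the threshold makes \<open>n\<close> positive, hence \<open>q n\<close>
    too.\<close>
  have bound: "\<bar>p n / q n - 1\<bar> \<le> 8 * s * real N / real n" if "n \<ge> 2 * N + 1" for n
  proof -
    have n: "real n > 0"
      using that by simp
    have l: "(real n)\<^sup>2 \<le> 4 * s * q n"
      using low that by simp
    have qpos: "q n > 0"
      using l n spos by (smt (verit) mult_pos_pos zero_less_mult_pos zero_less_power)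
    have "\<bar>p n / q n - 1\<bar> = \<bar>p n - q n\<bar> / q n"
      using qpos by (simp add: field_simps abs_divide)
    also have "\<dots> \<le> 2 * real N * real n / q n"
      using diff qpos by (simp add: divide_right_mono)
    also have "\<dots> \<le> 8 * s * real N / real n"
    proof -
      have "2 * real N * (real n)\<^sup>2 \<le> 2 * real N * (4 * s * q n)"
        using l by (intro mult_left_mono) auto
      then show ?thesis
        using n qpos by (simp add: field_simps power2_eq_square)
    qed
    finally show ?thesis .
  qed
  have "(\<lambda>n. 8 * s * real N / real n) \<longlonglongrightarrow> 0"
    by (rule lim_const_over_n)
  then have "(\<lambda>n. p n / q n - 1) \<longlonglongrightarrow> 0"
    by (rule Lim_null_comparison[rotated])
       (use bound in \<open>auto simp: eventually_sequentially\<close>)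
  then show ?thesis
    unfolding p_def q_def by (simp add: LIM_zero_iff)
qed

section \<open>Trajectories and their limit points\<close>

lemma funpow_in:
  assumes "f \<in> X \<rightarrow> X" "x \<in> X"
  shows "(f ^^ n) x \<in> X"
  using assms by (induction n) auto

lemma continuous_on_funpow:
  fixes f :: "'a::topological_space \<Rightarrow> 'a"
  assumes "continuous_on X f" "f \<in> X \<rightarrow> X"
  shows "continuous_on X (f ^^ n)"
proof (induction n)
  case (Suc n)
  have "(f ^^ n) ` X \<subseteq> X"
    using funpow_in[OF assms(2)] by auto
  then show ?case
    unfolding funpow.simps
    using Suc continuous_on_subset[OF assms(1)] by (intro continuous_on_compose)
qed auto

lemma omega_limit_set_subset:
  assumes "closed X" "\<And>n. (f ^^ n) x \<in> X"
  shows "omega_limit_set f x \<subseteq> X"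
proof
  fix y assume "y \<in> omega_limit_set f x"
  then obtain r :: "nat \<Rightarrow> nat" where "(\<lambda>k. (f ^^ r k) x) \<longlonglongrightarrow> y"
    by (auto simp: omega_limit_set_def)
  with assms show "y \<in> X"
    by (rule closed_sequentially)
qed

text \<open>Otherwise infinitely many iterates lie in the compact set \<open>X - V\<close>, and a
  convergent subsequence of them yields a limit point of the trajectory outside
  \<open>V\<close>.\<close>

lemma trajectory_eventually_in:
  fixes f :: "'a::metric_space \<Rightarrow> 'a"
  assumes "compact X" "\<And>n. (f ^^ n) x \<in> X" "open V" "omega_limit_set f x \<subseteq> V"
  shows "\<forall>\<^sub>F n in sequentially. (f ^^ n) x \<in> V"
proof (rule ccontr)
  assume "\<not> ?thesis"
  then have "\<exists>\<^sub>F n in sequentially. (f ^^ n) x \<notin> V"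
    by (simp add: frequently_def)
  then have inf: "infinite {n. (f ^^ n) x \<notin> V}"
    by (simp add: frequently_cofinite cofinite_eq_sequentially[symmetric])
  obtain r :: "nat \<Rightarrow> nat" where r: "strict_mono r" "\<And>n. (f ^^ r n) x \<notin> V"
    using infinite_enumerate[OF inf] by auto
  have "compact (X - V)"
    using assms by (simp add: compact_diff)
  moreover have "\<forall>n. (f ^^ r n) x \<in> X - V"
    using r assms by auto
  ultimately obtain l s where l: "l \<in> X - V" "strict_mono s" "((\<lambda>n. (f ^^ r n) x) \<circ> s) \<longlonglongrightarrow> l"
    unfolding compact_def by metis
  have "strict_mono (r \<circ> s)"
    using r(1) l(2) by (rule strict_mono_o)
  then have "l \<in> omega_limit_set f x"
    using l(3) unfolding omega_limit_set_def o_def by blast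
  then show False
    using l(1) assms(4) by auto
qed

section \<open>Separation and neighbourhoods in a compatible metric\<close>

lemma finite_separated:
  assumes "Metric_space X \<rho>" "finite S" "S \<subseteq> X"
  obtains e where "e > 0" "\<And>y z. y \<in> S \<Longrightarrow> z \<in> S \<Longrightarrow> y \<noteq> z \<Longrightarrow> e \<le> \<rho> y z"
proof -
  \<comment> \<open>The inserted 1 keeps \<open>D\<close> nonempty when \<open>S\<close> has at most
    one point, so that \<open>Min D\<close> is meaningful.\<close>
  define D where "D = insert 1 ((\<lambda>(y, z). \<rho> y z) ` {(y, z) \<in> S \<times> S. y \<noteq> z})"
  have "finite {(y, z) \<in> S \<times> S. y \<noteq> z}"
    by (rule finite_subset[of _ "S \<times> S"]) (use assms(2) in auto)
  then have fin: "finite D" "D \<noteq> {}"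
    by (auto simp: D_def)
  have "\<forall>d\<in>D. 0 < d"
    using Metric_space.mdist_pos_less[OF assms(1)] assms(3) by (auto simp: D_def)
  then have "Min D > 0"
    using fin by simp
  moreover have "Min D \<le> \<rho> y z" if "y \<in> S" "z \<in> S" "y \<noteq> z" for y z
    using fin that by (intro Min_le) (auto simp: D_def)
  ultimately show ?thesis
    using that by blast
qed

text \<open>Translates \<open>\<rho>\<close>-closeness into the ambient topology: balls of
  \<open>\<rho>\<close> are relatively open in \<open>X\<close>, continuity of each iterate pulls
  them back, and the finitely many times \<open>k < m\<close> allow the resulting open sets to be
  intersected.\<close>

lemma compatible_metric_iterates_nhd:
  fixes f :: "'a::topological_space \<Rightarrow> 'a"
  assumes "Metric_space X \<rho>" "Metric_space.mtopology X \<rho> = top_of_set X"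
    and "continuous_on X f" "f \<in> X \<rightarrow> X" "y \<in> X" "e > 0"
  obtains U where "open U" "y \<in> U"
    "\<And>u k. u \<in> U \<Longrightarrow> u \<in> X \<Longrightarrow> k < m \<Longrightarrow> \<rho> ((f ^^ k) y) ((f ^^ k) u) < e"
proof -
  interpret Metric_space X \<rho> by fact
  have "\<exists>U. open U \<and> y \<in> U \<and> (\<forall>u\<in>U \<inter> X. \<rho> ((f ^^ k) y) ((f ^^ k) u) < e)" for k
  proof -
    have "openin (top_of_set X) (mball ((f ^^ k) y) e)"
      using openin_mball assms(2) by metis
    then obtain B where B: "open B" "mball ((f ^^ k) y) e = X \<inter> B"
      by (auto simp: openin_open)
    have fy: "(f ^^ k) y \<in> X"
      using assms by (intro funpow_in)
    then have "(f ^^ k) y \<in> B"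
      using B \<open>e > 0\<close> by (metis IntD2 centre_in_mball_iff)
    then obtain U where "open U" "y \<in> U" "\<And>u. u \<in> X \<Longrightarrow> u \<in> U \<Longrightarrow> (f ^^ k) u \<in> B"
      using continuous_on_funpow[OF assms(3,4)] B(1) \<open>y \<in> X\<close>
      unfolding continuous_on_topological by metis
    moreover have "(f ^^ k) u \<in> X" if "u \<in> X" for u
      using assms(4) that by (rule funpow_in)
    ultimately show ?thesis
      using B(2) by (metis Int_iff in_mball)
  qed
  then obtain U where U: "\<And>k. open (U k)" "\<And>k. y \<in> U k"
    "\<And>k u. u \<in> U k \<Longrightarrow> u \<in> X \<Longrightarrow> \<rho> ((f ^^ k) y) ((f ^^ k) u) < e"
    by (metis IntI)
  show ?thesis
    by (rule that[of "\<Inter>k<m. U k"]) (use U in auto)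
qed

section \<open>Determinism at a fixed small radius\<close>

lemma rdet_tendsto_1:
  fixes f :: "'a::metric_space \<Rightarrow> 'a"
  assumes M: "Metric_space X \<rho>" and T: "Metric_space.mtopology X \<rho> = top_of_set X"
    and X: "compact X" and f: "continuous_on X f" "f \<in> X \<rightarrow> X" and "x \<in> X"
    and S: "finite (omega_limit_set f x)" and m: "m \<ge> 1" and e: "e > 0"
    and sep: "\<And>y z. y \<in> omega_limit_set f x \<Longrightarrow> z \<in> omega_limit_set f x \<Longrightarrow> y \<noteq> z
                \<Longrightarrow> 2 * e < \<rho> y z"
  shows "(\<lambda>n. rdet \<rho> f m x n e) \<longlonglongrightarrow> 1"
proof -
  interpret Metric_space X \<rho> by fact
  define S where "S = omega_limit_set f x"
  define a where "a n = (f ^^ n) x" for n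
  have a: "a n \<in> X" for n
    unfolding a_def using f(2) \<open>x \<in> X\<close> by (rule funpow_in)
  have SX: "S \<subseteq> X"
    unfolding S_def using X a by (intro omega_limit_set_subset) (auto simp: a_def compact_imp_closed)
  \<comment> \<open>The radius \<open>e / 2\<close> serves twice: points this near one limit point
    are at most \<open>e\<close> apart, and points this near two distinct limit points, which are
    more than \<open>2 * e\<close> apart, stay more than \<open>e\<close> apart. Controlling all
    times \<open>k < m\<close> makes the first claim hold in Bowen's metric.\<close>
  have "\<exists>U. open U \<and> y \<in> U \<and> (\<forall>u\<in>U \<inter> X. \<forall>k<m. \<rho> ((f ^^ k) y) ((f ^^ k) u) < e / 2)"
    if "y \<in> S" for y
  proof -
    have "y \<in> X" "e / 2 > 0"
      using SX e that by auto
    then obtain V where "open V" "y \<in> V"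
      "\<And>u k. u \<in> V \<Longrightarrow> u \<in> X \<Longrightarrow> k < m \<Longrightarrow> \<rho> ((f ^^ k) y) ((f ^^ k) u) < e / 2"
      using compatible_metric_iterates_nhd[OF M T f, of y "e / 2" m] by metis
    then show ?thesis
      by blast
  qed
  then have "\<exists>U. \<forall>y\<in>S. open (U y) \<and> y \<in> U y
      \<and> (\<forall>u\<in>U y \<inter> X. \<forall>k<m. \<rho> ((f ^^ k) y) ((f ^^ k) u) < e / 2)"
    by (intro bchoice ballI)
  then obtain U where U: "\<And>y. y \<in> S \<Longrightarrow> open (U y)" "\<And>y. y \<in> S \<Longrightarrow> y \<in> U y"
    "\<And>y u k. y \<in> S \<Longrightarrow> u \<in> U y \<Longrightarrow> u \<in> X \<Longrightarrow> k < m \<Longrightarrow> \<rho> ((f ^^ k) y) ((f ^^ k) u) < e / 2"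
    by blast
  have "\<forall>\<^sub>F n in sequentially. (f ^^ n) x \<in> (\<Union>y\<in>S. U y)"
    using X a U by (intro trajectory_eventually_in) (auto simp: S_def a_def)
  then obtain N where N: "\<And>n. n \<ge> N \<Longrightarrow> \<exists>y\<in>S. a n \<in> U y"
    unfolding eventually_sequentially a_def by auto
  \<comment> \<open>\<open>b\<close> labels each late time with a limit point that the trajectory is
    then near; it is the finite-valued label for the counting argument.\<close>
  then obtain b where b: "\<And>n. n \<ge> N \<Longrightarrow> b n \<in> S" "\<And>n. n \<ge> N \<Longrightarrow> a n \<in> U (b n)"
    by metis
  have close: "\<rho> ((f ^^ k) (b n)) ((f ^^ k) (a n)) < e / 2" if "n \<ge> N" "k < m" for n k
    using U(3) b a that by blast
  have fX: "(f ^^ k) u \<in> X" if "u \<in> X" for k u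
    using f(2) that by (rule funpow_in)
  have same: "\<rho> ((f ^^ k) (a i)) ((f ^^ k) (a j)) \<le> e"
    if "i \<ge> N" "j \<ge> N" "b i = b j" "k < m" for i j k
  proof -
    have "\<rho> ((f ^^ k) (a i)) ((f ^^ k) (a j))
        \<le> \<rho> ((f ^^ k) (a i)) ((f ^^ k) (b i)) + \<rho> ((f ^^ k) (b i)) ((f ^^ k) (a j))"
      using a b SX that by (intro triangle fX) auto
    then show ?thesis
      using close[of i k] close[of j k] that by (simp add: commute)
  qed
  \<comment> \<open>Only time 0 is compared here; \<open>m \<ge> 1\<close> makes
    \<open>close\<close> available for it.\<close>
  have apart: "e < \<rho> (a i) (a j)" if "i \<ge> N" "j \<ge> N" "b i \<noteq> b j" for i j
  proof -
    have bX: "b i \<in> X" "b j \<in> X"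
      using b SX that by auto
    have "\<rho> (b i) (b j) \<le> \<rho> (b i) (a i) + (\<rho> (a i) (a j) + \<rho> (a j) (b j))"
      using triangle[of "b i" "a i" "b j"] triangle[of "a i" "a j" "b j"] a bX by simp
    moreover have "2 * e < \<rho> (b i) (b j)"
      using sep b that by (simp add: S_def)
    ultimately show ?thesis
      using close[of i 0] close[of j 0] that m by (simp add: commute)
  qed
  \<comment> \<open>Here \<open>k\<close> is the order of Bowen's metric: \<open>k = m\<close>
    serves the numerator and \<open>k = 1\<close> the denominator.\<close>
  have iff: "bowen_dist \<rho> f k ((f ^^ i) x) ((f ^^ j) x) \<le> e \<longleftrightarrow> b i = b j"
    if "i \<ge> N" "j \<ge> N" "1 \<le> k" "k \<le> m" for i j k
  proof
    assume "bowen_dist \<rho> f k ((f ^^ i) x) ((f ^^ j) x) \<le> e"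
    \<comment> \<open>A Bowen metric of order at least 1 dominates \<open>\<rho>\<close> through its
      term at time 0.\<close>
    then have "\<rho> ((f ^^ 0) (a i)) ((f ^^ 0) (a j)) \<le> e"
      unfolding bowen_dist_le_iff[OF that(3)] a_def using that(3)
      by (metis less_le_trans zero_less_one)
    then show "b i = b j"
      using apart[of i j] that by force
  next
    assume "b i = b j"
    then show "bowen_dist \<rho> f k ((f ^^ i) x) ((f ^^ j) x) \<le> e"
      unfolding bowen_dist_le_iff[OF that(3)] a_def[symmetric] using same that by auto
  qed
  have "(\<lambda>n. real (card {(i, j). i < n \<and> j < n \<and> bowen_dist \<rho> f m ((f ^^ i) x) ((f ^^ j) x) \<le> e})
      / real (card {(i, j). i < n \<and> j < n \<and> bowen_dist \<rho> f 1 ((f ^^ i) x) ((f ^^ j) x) \<le> e}))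
      \<longlonglongrightarrow> 1"
    by (rule card_pairs_ratio_tendsto_1[where S = S and b = b and N = N])
       (use S m b iff in \<open>auto simp: S_def\<close>)
  \<comment> \<open>The normalising factors \<open>1 / n^2\<close> cancel once
    \<open>n \<ge> 1\<close>.\<close>
  then show ?thesis
    by (rule Lim_transform_eventually)
       (auto simp: eventually_sequentially rdet_def corr_sum_def intro!: exI[of _ 1])
qed

theorem theoremB:
  fixes \<rho> :: "real \<Rightarrow> real \<Rightarrow> real" and f :: "real \<Rightarrow> real" and x :: real and m :: nat
  assumes "Metric_space {0..1} \<rho>"
    and "Metric_space.mtopology {0..1} \<rho> = top_of_set {0..1}"
    and "continuous_on {0..1} f"
    and "f \<in> {0..1} \<rightarrow> {0..1}"
    and "x \<in> {0..1}"
    and "finite (omega_limit_set f x)"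
    and "m \<ge> 1"
  shows "(\<forall>\<^sub>F \<epsilon> in at_right 0. convergent (\<lambda>n. rdet \<rho> f m x n \<epsilon>)) \<and>
         ((\<lambda>\<epsilon>. asym_rdet \<rho> f m x \<epsilon>) \<longlongrightarrow> 1) (at_right 0)"
proof -
  have "omega_limit_set f x \<subseteq> {0..1}"
    using assms(4,5) by (intro omega_limit_set_subset funpow_in) auto
  then obtain d where d: "d > 0"
    "\<And>y z. y \<in> omega_limit_set f x \<Longrightarrow> z \<in> omega_limit_set f x \<Longrightarrow> y \<noteq> z \<Longrightarrow> d \<le> \<rho> y z"
    using finite_separated[OF assms(1,6)] by metis
  have lim: "(\<lambda>n. rdet \<rho> f m x n \<epsilon>) \<longlonglongrightarrow> 1" if "0 < \<epsilon>" "\<epsilon> < d / 2" for \<epsilon>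
    by (rule rdet_tendsto_1[OF assms(1,2) _ assms(3-7)]) (use d(2) that in force)+
  have small: "\<forall>\<^sub>F \<epsilon> in at_right 0. 0 < \<epsilon> \<and> \<epsilon> < d / 2"
    using d(1) by (auto simp: eventually_at_right_field intro!: exI[of _ "d / 2"])
  show ?thesis
  proof
    show "\<forall>\<^sub>F \<epsilon> in at_right 0. convergent (\<lambda>n. rdet \<rho> f m x n \<epsilon>)"
      using small by eventually_elim (use lim in \<open>auto simp: convergent_def\<close>)
    \<comment> \<open>The determinism equals 1 at every small radius, so the outer limit is that of
      an eventually constant function.\<close>
    have "\<forall>\<^sub>F \<epsilon> in at_right 0. asym_rdet \<rho> f m x \<epsilon> = 1"
      using small by eventually_elim (use lim in \<open>auto simp: asym_rdet_def intro: limI\<close>)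
    then show "((\<lambda>\<epsilon>. asym_rdet \<rho> f m x \<epsilon>) \<longlongrightarrow> 1) (at_right 0)"
      by (rule tendsto_eventually)
  qed
qed

end
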